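(* Let $n\ge 2$ and let $\overrightarrow{\mathcal{G}}_{n}$ be the direct sum graph of type I. Then: 1. $\chi_{r}(\overrightarrow{\mathcal{G}}_{n})=\chi_{r}(\overrightarrow{P}_{2^{n}-1})=n$, and the minimum labeling of $\overrightarrow{\mathcal{G}}_{n}$ is unique; 2. the total number of edges in $\overrightarrow{\mathcal{G}}_{n}$ is $2S(n+1,3)=3^{n}-2^{n+1}+1$; 3. an edge $e$ is admissible of type I for $\overrightarrow{P}_{2^n-1}$ if and only if $e$ is an edge of $H(\overrightarrow{\mathcal{G}}_{n})$; 4. the total number of admissible edges of type I for $\overrightarrow{P}_{2^n-1}$ is $2\left(S(n+1,3)-S(n,2)\right)$.
   Context: All directed graphs are finite, with no loops and at most one edge in each direction between two vertices. $S(n,k)$ is the Stirling number of the second kind. A $k$-ranking of a directed graph $G$ is a labeling $f:V(G)\to\{1,\dots,k\}$ such that whenever $u\ne v$ and $f(u)=f(v)$, every directed path connecting $u$ and $v$ (in either direction) contains a vertex $w$ with $f(w)>f(u)$. The rank number $\chi_r(G)$ is the smallest $k$ such that $G$ has a $k$-ranking. A minimum labeling of $G$ is a $k$-ranking with $k=\chi_r(G)$. $\overrightarrow{P}_{\eta}$ is the directed path with vertices $v_1,\dots,v_\eta$ and edges $v_i\to v_{i+1}$, $1\le i<\eta$. An edge $e$ not in a directed graph $G$, with both ends in $V(G)$, is admissible for $G$ if $\chi_r(G\cup\{e\})=\chi_r(G)$. An admissible edge $v_a\to v_b$ for $\overrightarrow{P}_\eta$ is of type I if it has the same direction as the edges of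 the path, i.e. $a<b$. Direct sum graphs of type I are defined recursively. $\overrightarrow{\mathcal{G}}_2=\overrightarrow{P}_3$. Given $\overrightarrow{\mathcal{G}}_i$ with vertices $v_1,\dots,v_{2^i-1}$, let $\overrightarrow{\mathcal{G}}_i'$ be a copy of it with vertices $w_1,\dots,w_{2^i-1}$ ($w_t$ corresponding to $v_t$). Then $\overrightarrow{\mathcal{G}}_{i+1}$ has vertex set $V(\overrightarrow{\mathcal{G}}_i)\cup V(\overrightarrow{\mathcal{G}}_i')\cup\{v_{2^i}\}$ and as edges all edges of $\overrightarrow{\mathcal{G}}_i$ and $\overrightarrow{\mathcal{G}}_i'$, the edges $v_j\to v_{2^i}$ and $v_{2^i}\to w_j$ for $1\le j\le 2^i-1$, and the edges $v_k\to w_j$ for every edge $v_k\to v_j$ of $\overrightarrow{\mathcal{G}}_i$. Afterwards $w_t$ is renamed $v_{2^i+t}$, so that $\overrightarrow{\mathcal{G}}_{i+1}$ has vertices $v_1,\dots,v_{2^{i+1}-1}$ and contains $\overrightarrow{P}_{2^{i+1}-1}$. $H(\overrightarrow{\mathcal{G}}_n)$ is the graph with vertex set $V(\overrightarrow{\mathcal{G}}_n)$ whose edges are the edges of $\overrightarrow{\mathcal{G}}_n$ that are not edges of $\overrightarrow{P}_{2^n-1}$. *)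

theory Defs
  imports "HOL-Combinatorics.Stirling" "Graph_Theory.Pair_Digraph"
begin

text \<open>
  A labeling is a function on the vertex set only, represented extensionally (value
  \<open>undefined\<close> elsewhere), so that uniqueness of a labeling can be stated by plain equality.
  Both directions of a connecting path are covered since \<open>u\<close>, \<open>v\<close> range over ordered pairs.
\<close>

definition k_ranking :: "nat \<Rightarrow> 'a pair_pre_digraph \<Rightarrow> ('a \<Rightarrow> nat) \<Rightarrow> bool" where
  "k_ranking k G f \<longleftrightarrow>
     f \<in> pverts G \<rightarrow>\<^sub>E {1..k} \<and>
     (\<forall>u \<in> pverts G. \<forall>v \<in> pverts G. u \<noteq> v \<and> f u = f v \<longrightarrow>
        (\<forall>p. pre_digraph.apath (with_proj G) u p v \<longrightarrow>
           (\<exists>w \<in> set (pre_digraph.awalk_verts (with_proj G) u p). f w > f u)))"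

definition rank_number :: "'a pair_pre_digraph \<Rightarrow> nat" where
  "rank_number G = (LEAST k. \<exists>f. k_ranking k G f)"

definition minimum_labeling :: "'a pair_pre_digraph \<Rightarrow> ('a \<Rightarrow> nat) \<Rightarrow> bool" where
  "minimum_labeling G f \<longleftrightarrow> k_ranking (rank_number G) G f"

definition directed_path :: "nat \<Rightarrow> nat pair_pre_digraph" where
  "directed_path m = \<lparr> pverts = {1..m}, parcs = {(i, i + 1) | i. 1 \<le> i \<and> i < m} \<rparr>"

text \<open>The condition \<open>fst e \<noteq> snd e\<close> reflects the convention that digraphs have no loops.\<close>

definition admissible :: "'a pair_pre_digraph \<Rightarrow> 'a \<times> 'a \<Rightarrow> bool" where
  "admissible G e \<longleftrightarrow>
     fst e \<in> pverts G \<and> snd e \<in> pverts G \<and> fst e \<noteq> snd e \<and> e \<notin> parcs G \<and>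
     rank_number (G\<lparr>parcs := insert e (parcs G)\<rparr>) = rank_number G"

definition admissible_type_I :: "nat \<Rightarrow> nat \<times> nat \<Rightarrow> bool" where
  "admissible_type_I m e \<longleftrightarrow> admissible (directed_path m) e \<and> fst e < snd e"

text \<open>
  One step of the recursion, for a graph \<open>G\<close> on the vertices \<open>1, \<dots>, 2 ^ i - 1\<close>. The vertex \<open>w\<^sub>t\<close>
  of the disjoint copy is named \<open>2 ^ i + t\<close> from the outset.
\<close>

definition direct_sum_step :: "nat \<Rightarrow> nat pair_pre_digraph \<Rightarrow> nat pair_pre_digraph" where
  "direct_sum_step i G =
     (let w = (\<lambda>t. 2 ^ i + t) in
      \<lparr> pverts = pverts G \<union> w ` pverts G \<union> {2 ^ i},
        parcs = parcs G
          \<union> {(w a, w b) | a b. (a, b) \<in> parcs G}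
          \<union> {(j, 2 ^ i) | j. 1 \<le> j \<and> j \<le> 2 ^ i - 1}
          \<union> {(2 ^ i, w j) | j. 1 \<le> j \<and> j \<le> 2 ^ i - 1}
          \<union> {(k, w j) | k j. (k, j) \<in> parcs G} \<rparr>)"

text \<open>The recursion starts at index 2; the values at 0 and 1 are irrelevant.\<close>

primrec direct_sum_graph :: "nat \<Rightarrow> nat pair_pre_digraph" where
  "direct_sum_graph 0 = directed_path 3"
| "direct_sum_graph (Suc i) =
     (if i < 2 then directed_path 3 else direct_sum_step i (direct_sum_graph i))"

definition H_graph :: "nat \<Rightarrow> nat pair_pre_digraph" where
  "H_graph n = \<lparr> pverts = pverts (direct_sum_graph n),
                 parcs = parcs (direct_sum_graph n) - parcs (directed_path (2 ^ n - 1)) \<rparr>"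

end

theory Submission
  imports Defs "HOL-Computational_Algebra.Primes"
begin

text \<open>
  In a path ranked with \<open>n\<close> labels the label \<open>n\<close> occurs at most once and separates two paths ranked
  with \<open>n - 1\<close> labels. Hence the path on \<open>2 ^ n - 1\<close> vertices has a unique minimum labeling, the
  ruler labeling \<open>i \<mapsto> 1 + multiplicity 2 i\<close>, and \<open>n\<close> is the smallest number of labels. An edge is
  therefore admissible iff the ruler labeling survives its insertion. For a forward edge
  \<open>(a, b)\<close> this means that \<open>a mod 2 ^ m < b mod 2 ^ m\<close> for every \<open>m\<close> such that \<open>2 ^ m\<close> divides
  neither \<open>a\<close> nor \<open>b\<close>. The edges with this property obey the recursion of the direct sum graphs, and
  all of them together still respect the ruler labeling.
\<close>

section \<open>Rankings via vertex lists\<close>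

text \<open>There are no parallel arcs in a pair digraph, so a walk can be given by its vertices
  instead of its arcs.\<close>

lemma pcas_pawalk_verts_iff:
  "(\<exists>p. set p \<subseteq> A \<and> pcas u p v \<and> pawalk_verts u p = vs) \<longleftrightarrow>
     vs \<noteq> [] \<and> hd vs = u \<and> last vs = v \<and> successively (\<lambda>x y. (x, y) \<in> A) vs"
proof (induction vs arbitrary: u)
  case Nil
  have "pawalk_verts u p \<noteq> []" for p
    by (cases p) auto
  then show ?case by simp
next
  case (Cons x xs)
  show ?case
  proof (cases xs)
    case Nil
    have verts: "pawalk_verts w p = [x] \<longleftrightarrow> p = [] \<and> w = x" for w p
    proof (cases p)
      case (Cons e es)
      then show ?thesis by (cases e; cases es) auto
    qed auto
    show ?thesis unfolding Nil verts by auto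
  next
    case (Cons y ys)
    have "(\<exists>p. set p \<subseteq> A \<and> pcas u p v \<and> pawalk_verts u p = x # xs) \<longleftrightarrow>
          x = u \<and> (\<exists>y. (u, y) \<in> A \<and> (\<exists>p. set p \<subseteq> A \<and> pcas y p v \<and> pawalk_verts y p = xs))"
      (is "?L \<longleftrightarrow> ?R")
    proof
      assume ?L
      then obtain p where p: "set p \<subseteq> A" "pcas u p v" "pawalk_verts u p = x # xs" by blast
      have "p \<noteq> []" using p(3) Cons by (cases p) simp_all
      then obtain y q where "p = (fst (hd p), y) # q"
        by (metis list.exhaust list.sel(1) prod.collapse)
      then have p': "p = (u, y) # q" using p(2) by (metis fst_conv pcas.simps(2))
      have "(u, y) \<in> A" "set q \<subseteq> A" "pcas y q v" "x = u" "pawalk_verts y q = xs"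
        using p unfolding p' by simp_all
      then show ?R by blast
    next
      assume ?R
      then obtain y p where "x = u" "(u, y) \<in> A" "set p \<subseteq> A" "pcas y p v" "pawalk_verts y p = xs"
        by blast
      then have "set ((u, y) # p) \<subseteq> A \<and> pcas u ((u, y) # p) v \<and> pawalk_verts u ((u, y) # p) = x # xs"
        by simp
      then show ?L by blast
    qed
    then show ?thesis unfolding Cons.IH by (auto simp: Cons)
  qed
qed

text \<open>Trades arc paths for distinct vertex lists, so that concrete paths can be written down
  as lists of consecutive integers.\<close>

lemma k_ranking_iff:
  "k_ranking k G f \<longleftrightarrow>
     f \<in> pverts G \<rightarrow>\<^sub>E {1..k} \<and>
     (\<forall>vs. vs \<noteq> [] \<and> hd vs \<in> pverts G \<and> last vs \<in> pverts G \<and> hd vs \<noteq> last vs \<and> distinct vs \<and>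
        successively (\<lambda>x y. (x, y) \<in> parcs G) vs \<and> f (hd vs) = f (last vs) \<longrightarrow>
        (\<exists>w \<in> set vs. f (hd vs) < f w))"
  (is "?L \<longleftrightarrow> ?E \<and> ?R")
proof
  assume L: ?L
  have ?R
  proof (intro allI impI, elim conjE)
    fix vs
    assume vs: "vs \<noteq> []" "hd vs \<in> pverts G" "last vs \<in> pverts G" "hd vs \<noteq> last vs" "distinct vs"
      "successively (\<lambda>x y. (x, y) \<in> parcs G) vs" "f (hd vs) = f (last vs)"
    then obtain p where p: "set p \<subseteq> parcs G" "pcas (hd vs) p (last vs)" "pawalk_verts (hd vs) p = vs"
      using pcas_pawalk_verts_iff[of "parcs G" "hd vs" "last vs" vs] by blast
    then have "pre_digraph.apath (with_proj G) (hd vs) p (last vs)"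
      using vs
      by (simp add: pre_digraph.apath_def pre_digraph.awalk_def cas_with_proj_eq awalk_verts_with_proj_eq)
    with L vs have "\<exists>w \<in> set (pre_digraph.awalk_verts (with_proj G) (hd vs) p). f (hd vs) < f w"
      unfolding k_ranking_def by metis
    then show "\<exists>w \<in> set vs. f (hd vs) < f w"
      using p(3) by (simp add: awalk_verts_with_proj_eq)
  qed
  with L show "?E \<and> ?R" by (simp add: k_ranking_def)
next
  assume R: "?E \<and> ?R"
  then have ranked: "\<exists>w \<in> set vs. f (hd vs) < f w"
    if "vs \<noteq> []" "hd vs \<in> pverts G" "last vs \<in> pverts G" "hd vs \<noteq> last vs" "distinct vs"
      "successively (\<lambda>x y. (x, y) \<in> parcs G) vs" "f (hd vs) = f (last vs)" for vs
    using that by simp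
  show ?L unfolding k_ranking_def
  proof (intro conjI ballI impI allI)
    fix u v p
    assume uv: "u \<in> pverts G" "v \<in> pverts G" "u \<noteq> v \<and> f u = f v"
      and "pre_digraph.apath (with_proj G) u p v"
    moreover define vs where "vs = pawalk_verts u p"
    ultimately have p: "set p \<subseteq> parcs G" "pcas u p v" "distinct vs"
      by (simp_all add: pre_digraph.apath_def pre_digraph.awalk_def cas_with_proj_eq awalk_verts_with_proj_eq)
    then have "vs \<noteq> [] \<and> hd vs = u \<and> last vs = v \<and> successively (\<lambda>x y. (x, y) \<in> parcs G) vs"
      unfolding pcas_pawalk_verts_iff[symmetric] vs_def by blast
    then show "\<exists>w \<in> set (pre_digraph.awalk_verts (with_proj G) u p). f u < f w"
      using ranked[of vs] uv p(3) by (simp add: vs_def awalk_verts_with_proj_eq)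
  qed (use R in simp)
qed

lemma k_ranking_subgraph:
  assumes "k_ranking k G f" "pverts H = pverts G" "parcs H \<subseteq> parcs G"
  shows "k_ranking k H f"
proof -
  have "successively (\<lambda>x y. (x, y) \<in> parcs G) vs"
    if "successively (\<lambda>x y. (x, y) \<in> parcs H) vs" for vs
    using that by (rule successively_mono) (use assms(3) in auto)
  with assms(1,2) show ?thesis unfolding k_ranking_iff by metis
qed

lemma rank_number_eqI:
  assumes "k_ranking k G f" "\<And>j g. k_ranking j G g \<Longrightarrow> k \<le> j"
  shows "rank_number G = k"
  unfolding rank_number_def by (rule Least_equality) (use assms in blast)+


section \<open>Rankings of an interval\<close>

text \<open>The ranking condition for the path on the vertices \<open>a\<close>, ...,
  \<open>b - 1\<close>, whose only paths are integer intervals. The half-open form makes cutting at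
  a vertex \<open>x\<close> leave the intervals from \<open>a\<close> to \<open>x\<close> and from
  \<open>Suc x\<close> to \<open>b\<close>.\<close>

definition interval_ranking :: "nat \<Rightarrow> nat \<Rightarrow> nat \<Rightarrow> (nat \<Rightarrow> nat) \<Rightarrow> bool" where
  "interval_ranking k a b f \<longleftrightarrow>
     (\<forall>i\<in>{a..<b}. f i \<in> {1..k}) \<and>
     (\<forall>i\<ge>a. \<forall>j<b. i < j \<and> f i = f j \<longrightarrow> (\<exists>w\<in>{i..j}. f i < f w))"

lemma interval_ranking_subinterval:
  assumes "interval_ranking k a b f" "a \<le> a'" "b' \<le> b" "\<And>i. a' \<le> i \<Longrightarrow> i < b' \<Longrightarrow> f i \<le> l"
  shows "interval_ranking l a' b' f"
  using assms unfolding interval_ranking_def by auto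

lemma interval_ranking_remove_top:
  assumes "interval_ranking (Suc k) a b f"
  obtains (unused) "interval_ranking k a b f"
  | (used) x where "a \<le> x" "x < b" "f x = Suc k"
      "interval_ranking k a x f" "interval_ranking k (Suc x) b f"
proof (cases "\<exists>x. a \<le> x \<and> x < b \<and> f x = Suc k")
  case True
  then obtain x where x: "a \<le> x" "x < b" "f x = Suc k" by blast
  have le: "f i \<le> Suc k" if "a \<le> i" "i < b" for i
    using assms that by (auto simp: interval_ranking_def)
  \<comment> \<open>Two occurrences of the top label would need a label above \<open>Suc k\<close>
    between them.\<close>
  have sep: False if "i < j" "a \<le> i" "j < b" "f i = Suc k" "f j = Suc k" for i j
  proof -
    from assms that obtain w where "w \<in> {i..j}" "f i < f w"
      unfolding interval_ranking_def by metis
    with le[of w] that show False by auto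
  qed
  have "f i \<le> k" if "a \<le> i" "i < b" "i \<noteq> x" for i
    using le[of i] sep[of i x] sep[of x i] x that by (cases "f i = Suc k") (auto simp: neq_iff)
  then have "interval_ranking k a x f" "interval_ranking k (Suc x) b f"
    using x by (auto intro!: interval_ranking_subinterval[OF assms])
  with x used show ?thesis by blast
next
  case False
  have "f i \<le> Suc k" if "a \<le> i" "i < b" for i
    using assms that by (auto simp: interval_ranking_def)
  with False have "f i \<le> k" if "a \<le> i" "i < b" for i
    using that by (metis le_SucE)
  with assms have "interval_ranking k a b f"
    by (auto intro!: interval_ranking_subinterval[OF assms])
  with unused show ?thesis .
qed

text \<open>Each side of the vertex with the top label has at most \<open>2 ^ k - 1\<close>
  vertices, and \<open>2 * (2 ^ k - 1) + 1 < 2 ^ Suc k\<close>.\<close>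

lemma interval_ranking_length:
  assumes "interval_ranking k a b f"
  shows "b - a < 2 ^ k"
  using assms
proof (induction k arbitrary: a b)
  case 0
  then show ?case by (force simp: interval_ranking_def)
next
  case (Suc k)
  from Suc.prems show ?case
  proof (cases rule: interval_ranking_remove_top)
    case unused
    then show ?thesis using Suc.IH[of a b] by simp
  next
    case (used x)
    then show ?thesis using Suc.IH[of a x] Suc.IH[of "Suc x" b] by simp
  qed
qed


section \<open>The ruler labeling\<close>

definition ruler :: "nat \<Rightarrow> nat" where
  "ruler x = Suc (multiplicity 2 x)"

text \<open>Turns comparisons of labels into divisibility. The number 0 is excluded because every
  power of 2 divides it.\<close>

lemma ruler_le_iff: "x > 0 \<Longrightarrow> ruler x \<le> m \<longleftrightarrow> \<not> 2 ^ m dvd x"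
  by (simp add: ruler_def power_dvd_iff_le_multiplicity not_le Suc_le_eq)

lemma ruler_eqI:
  assumes "x > 0" "y > 0" "\<And>m. 2 ^ m dvd x \<longleftrightarrow> 2 ^ m dvd y"
  shows "ruler x = ruler y"
  using assms ruler_le_iff[of x] ruler_le_iff[of y] by (metis le_antisym order_refl)

lemma ruler_pow2 [simp]: "ruler (2 ^ m) = Suc m"
  by (simp add: ruler_def multiplicity_same_power)

text \<open>Powers up to \<open>2 ^ m\<close> divide the added multiple, and larger ones divide
  neither side because \<open>2 ^ m\<close> does not divide \<open>r\<close>.\<close>

lemma ruler_shift:
  assumes "0 < r" "r < 2 ^ m"
  shows "ruler (2 ^ m * c + r) = ruler r"
proof (rule ruler_eqI)
  fix l
  show "2 ^ l dvd 2 ^ m * c + r \<longleftrightarrow> 2 ^ l dvd r"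
  proof (cases "l \<le> m")
    case True
    then show ?thesis by (simp add: le_imp_power_dvd dvd_add_right_iff)
  next
    case False
    then have "(2::nat) ^ m dvd 2 ^ l" by (simp add: le_imp_power_dvd)
    moreover have "\<not> (2::nat) ^ m dvd r" "\<not> (2::nat) ^ m dvd 2 ^ m * c + r"
      using assms by (auto dest: dvd_imp_le simp: dvd_add_right_iff)
    ultimately show ?thesis using dvd_trans by blast
  qed
qed (use assms in auto)

text \<open>An odd multiple of \<open>2 ^ k\<close> leaves the remainder \<open>2 ^ k\<close> modulo
  \<open>2 ^ Suc k\<close>. Hence vertices with the same label \<open>m\<close> agree modulo
  \<open>2 ^ m\<close>.\<close>

lemma ruler_mod:
  assumes "x > 0"
  shows "x mod 2 ^ ruler x = 2 ^ (ruler x - 1)"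
proof -
  let ?k = "multiplicity 2 x"
  have "2 ^ ?k dvd x" by (rule multiplicity_dvd)
  then obtain c where c: "x = 2 ^ ?k * c" by (rule dvdE)
  have "\<not> 2 ^ Suc ?k dvd x"
    using ruler_le_iff[of x "Suc ?k"] assms by (simp add: ruler_def)
  then have "odd c"
    using c by (metis dvd_def mult.assoc power_Suc2)
  then have "c mod 2 = 1" by presburger
  then show ?thesis
    using c mult_mod_right[of "2 ^ ?k" c 2] by (simp add: ruler_def mult.commute)
qed

text \<open>The top label splits a full interval exactly in the middle, since neither half can be longer
  than \<open>2 ^ k - 1\<close>.\<close>

lemma interval_ranking_unique:
  assumes "interval_ranking k (Suc c) (c + 2 ^ k) f" "0 < i" "i < 2 ^ k"
  shows "f (c + i) = ruler i"
  using assms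
proof (induction k arbitrary: c i)
  case (Suc k)
  from Suc.prems(1) show ?case
  proof (cases rule: interval_ranking_remove_top)
    case unused
    from interval_ranking_length[OF this] have False by simp
    then show ?thesis ..
  next
    case (used x)
    have "x - Suc c < 2 ^ k" "c + 2 ^ Suc k - Suc x < 2 ^ k"
      using used interval_ranking_length by blast+
    then have x: "x = c + 2 ^ k" using used by simp
    consider "i < 2 ^ k" | "i = 2 ^ k" | "2 ^ k < i" by linarith
    then show ?thesis
    proof cases
      case 1
      then show ?thesis using Suc.IH[of c i] used x Suc.prems by simp
    next
      case 2
      then show ?thesis using used x by simp
    next
      case 3
      \<comment> \<open>The right half is the same problem with \<open>c\<close> raised by
        \<open>2 ^ k\<close>, a shift that leaves the ruler labels of \<open>0 < r < 2 ^ k\<close>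
        unchanged.\<close>
      define r where "r = i - 2 ^ k"
      have r: "i = 2 ^ k + r" "0 < r" "r < 2 ^ k" using 3 Suc.prems by (auto simp: r_def)
      have "interval_ranking k (Suc (c + 2 ^ k)) (c + 2 ^ k + 2 ^ k) f"
        using used x by (simp add: mult_2 add.assoc)
      then have "f (c + 2 ^ k + r) = ruler r" using r by (intro Suc.IH)
      then show ?thesis using r ruler_shift[of r k 1] by (simp add: add.assoc)
    qed
  qed
qed simp


section \<open>The arcs respecting the ruler labeling\<close>

text \<open>A vertex has label at most \<open>m\<close> iff it is not divisible by \<open>2 ^ m\<close>. Along arcs between such
  vertices the residue modulo \<open>2 ^ m\<close> grows, while all vertices of label exactly \<open>m\<close> have the same
  residue.\<close>

definition residue_less :: "nat \<Rightarrow> nat \<Rightarrow> nat \<Rightarrow> bool" where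
  "residue_less n a b \<longleftrightarrow>
     (\<forall>m\<le>n. \<not> 2 ^ m dvd a \<longrightarrow> \<not> 2 ^ m dvd b \<longrightarrow> a mod 2 ^ m < b mod 2 ^ m)"

definition residue_arcs :: "nat \<Rightarrow> (nat \<times> nat) set" where
  "residue_arcs n = {(a, b). a \<in> {1..<2 ^ n} \<and> b \<in> {1..<2 ^ n} \<and> residue_less n a b}"

text \<open>For \<open>m = n\<close> the modulus divides neither end, and both ends are their own
  residues.\<close>

lemma residue_arcs_less: "(a, b) \<in> residue_arcs n \<Longrightarrow> a < b"
  by (auto simp: residue_arcs_def residue_less_def dest!: spec[of _ n] dest: dvd_imp_le)

text \<open>While the walk avoids multiples of \<open>2 ^ m\<close>, the residue grows at each arc;
  two vertices guarantee at least one arc.\<close>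

lemma residue_walk_mod:
  assumes "successively (\<lambda>x y. (x, y) \<in> residue_arcs n) vs" "length vs \<ge> 2" "m \<le> n"
    "\<And>w. w \<in> set vs \<Longrightarrow> \<not> 2 ^ m dvd w"
  shows "hd vs mod 2 ^ m < last vs mod 2 ^ m"
  using assms
proof (induction vs)
  case (Cons x xs)
  then obtain y ys where xs: "xs = y # ys" by (cases xs) auto
  have less: "x mod 2 ^ m < y mod 2 ^ m"
    using Cons.prems by (auto simp: residue_arcs_def residue_less_def xs)
  show ?case
  proof (cases ys)
    case Nil
    then show ?thesis using less xs by simp
  next
    case Cons': (Cons z zs)
    have "hd xs mod 2 ^ m < last xs mod 2 ^ m"
      by (rule Cons.IH) (use Cons.prems xs Cons' in auto)
    then show ?thesis using less xs by simp
  qed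
qed simp

text \<open>Two vertices of label \<open>m\<close> agree modulo \<open>2 ^ m\<close>, so a path
  between them must meet a multiple of \<open>2 ^ m\<close>, whose label exceeds
  \<open>m\<close>.\<close>

lemma ruler_ranks_residue_arcs:
  "k_ranking n \<lparr>pverts = {1..2 ^ n - 1}, parcs = residue_arcs n\<rparr> (restrict ruler {1..2 ^ n - 1})"
    (is "k_ranking n ?G ?f")
  unfolding k_ranking_iff
proof (intro conjI allI impI, goal_cases)
  case 1
  have "ruler x \<le> n" if "0 < x" "x \<le> 2 ^ n - 1" for x
    using that ruler_le_iff[of x n] dvd_imp_le[of "2 ^ n" x] by fastforce
  then show ?case by (auto simp: ruler_def)
next
  case (2 vs)
  then have vs: "vs \<noteq> []" "hd vs \<in> {1..2 ^ n - 1}" "last vs \<in> {1..2 ^ n - 1}" "hd vs \<noteq> last vs"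
    "successively (\<lambda>x y. (x, y) \<in> residue_arcs n) vs" "ruler (hd vs) = ruler (last vs)"
    by auto
  have len: "length vs \<ge> 2" using vs by (cases vs; cases "tl vs") auto
  \<comment> \<open>Every vertex but the last is the tail of an arc; the last one is a vertex by
    assumption.\<close>
  have in_verts: "w \<in> {1..2 ^ n - 1}" if "w \<in> set vs" for w
    using vs(5,3) that
  proof (induction vs)
    case (Cons x xs)
    then show ?case by (cases xs) (auto simp: residue_arcs_def)
  qed simp
  let ?m = "ruler (hd vs)"
  have "\<not> 2 ^ n dvd hd vs"
    using vs(2) dvd_imp_le[of "2 ^ n" "hd vs"] by fastforce
  then have "?m \<le> n" using vs(2) ruler_le_iff[of "hd vs" n] by simp
  moreover have "hd vs mod 2 ^ ?m = last vs mod 2 ^ ?m"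
    using ruler_mod[of "hd vs"] ruler_mod[of "last vs"] vs by simp
  ultimately obtain w where w: "w \<in> set vs" "2 ^ ?m dvd w"
    using residue_walk_mod[OF vs(5) len] by (metis less_irrefl)
  with in_verts[of w] have "?m < ruler w"
    using ruler_le_iff[of w ?m] by auto
  then show ?case using w in_verts[of w] vs by auto
qed

text \<open>Adding 1 raises the residue unless it wraps around to 0, which happens only if
  \<open>2 ^ m\<close> divides \<open>i + 1\<close>.\<close>

lemma directed_path_subset_residue_arcs: "parcs (directed_path (2 ^ n - 1)) \<subseteq> residue_arcs n"
proof -
  have "(i, i + 1) \<in> residue_arcs n" if "1 \<le> i" "i < 2 ^ n - 1" for i
  proof -
    have "i mod 2 ^ m < (i + 1) mod 2 ^ m" if "\<not> 2 ^ m dvd i + 1" for m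
      using that by (metis Suc_eq_plus1 lessI mod_Suc dvd_eq_mod_eq_0)
    then show ?thesis using that by (auto simp: residue_arcs_def residue_less_def)
  qed
  then show ?thesis by (auto simp: directed_path_def)
qed

lemma successively_upt_Suc:
  assumes "\<And>i. a \<le> i \<Longrightarrow> Suc i < b \<Longrightarrow> P i (Suc i)"
  shows "successively P [a..<b]"
  using assms by (auto simp: successively_conv_nth)

lemma k_ranking_directed_path:
  assumes "k_ranking k (directed_path m) f"
  shows "interval_ranking k 1 (Suc m) f"
  unfolding interval_ranking_def
proof (intro conjI ballI allI impI, goal_cases)
  case (1 i)
  then show ?case using assms by (auto simp: k_ranking_iff directed_path_def)
next
  case (2 i j)
  let ?vs = "[i..<Suc j]"
  have "successively (\<lambda>x y. (x, y) \<in> parcs (directed_path m)) ?vs"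
    by (rule successively_upt_Suc) (use 2 in \<open>auto simp: directed_path_def\<close>)
  moreover have "hd ?vs = i" "last ?vs = j" "?vs \<noteq> []" "distinct ?vs"
    using 2 by (auto simp: hd_upt simp del: upt_Suc)
  moreover have "i \<in> pverts (directed_path m)" "j \<in> pverts (directed_path m)"
    using 2 by (auto simp: directed_path_def)
  ultimately obtain w where "w \<in> set ?vs" "f i < f w"
    using assms 2 unfolding k_ranking_iff by (metis less_irrefl)
  then show ?case by (auto simp del: upt_Suc)
qed

text \<open>If \<open>(a, b)\<close> violates the residue condition modulo \<open>2 ^ m\<close>, let \<open>p\<close> carry the largest label
  between \<open>b mod 2 ^ m\<close> and \<open>a mod 2 ^ m\<close>. The translates of \<open>p\<close> just below \<open>a\<close> and just above \<open>b\<close>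
  are joined by a path through \<open>(a, b)\<close> on which no label exceeds theirs.\<close>

lemma residue_arcs_if_ranked:
  assumes rank: "k_ranking k G f" and verts: "pverts G = {1..2 ^ n - 1}"
    and path: "parcs (directed_path (2 ^ n - 1)) \<subseteq> parcs G"
    and ruler: "\<And>i. i \<in> {1..2 ^ n - 1} \<Longrightarrow> f i = ruler i"
    and arc: "(a, b) \<in> parcs G" "a \<in> {1..2 ^ n - 1}" "b \<in> {1..2 ^ n - 1}" "a < b"
  shows "(a, b) \<in> residue_arcs n"
proof (rule ccontr)
  assume "(a, b) \<notin> residue_arcs n"
  then obtain m where m: "m \<le> n" "\<not> 2 ^ m dvd a" "\<not> 2 ^ m dvd b" "b mod 2 ^ m \<le> a mod 2 ^ m"
    using arc by (auto simp: residue_arcs_def residue_less_def not_less)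
  define r s where "r = a mod 2 ^ m" and "s = b mod 2 ^ m"
  \<comment> \<open>The largest multiples of \<open>2 ^ m\<close> below \<open>a\<close> and
    \<open>b\<close>.\<close>
  define A B where "A = 2 ^ m * (a div 2 ^ m)" and "B = 2 ^ m * (b div 2 ^ m)"
  have rs: "0 < s" "s \<le> r" "r < 2 ^ m" "a = A + r" "b = B + s"
    using m by (auto simp: r_def s_def A_def B_def dvd_eq_mod_eq_0)
  have "Max (ruler ` {s..r}) \<in> ruler ` {s..r}"
    using rs by (intro Max_in) auto
  then obtain p where p: "p \<in> {s..r}" and Max: "Max (ruler ` {s..r}) = ruler p"
    by auto
  have max: "ruler q \<le> ruler p" if "q \<in> {s..r}" for q
    using that unfolding Max[symmetric] by simp
  define u v where "u = A + p" and "v = B + p"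
  have ruler_A: "ruler (A + q) = ruler q" and ruler_B: "ruler (B + q) = ruler q"
    if "q \<in> {s..r}" for q
    using ruler_shift[of q m] that rs by (auto simp: A_def B_def)
  \<comment> \<open>Since \<open>2 ^ m\<close> divides \<open>2 ^ n\<close>, the whole block of
    \<open>2 ^ m\<close> numbers starting at \<open>B\<close> lies below \<open>2 ^ n\<close>, so
    \<open>v\<close> is still a vertex.\<close>
  have "b div 2 ^ m < 2 ^ (n - m)"
    using arc(3) m(1) by (auto simp: less_mult_imp_div_less simp flip: power_add)
  then have "2 ^ m * Suc (b div 2 ^ m) \<le> 2 ^ m * 2 ^ (n - m)"
    by (intro mult_le_mono2) simp
  then have "B + 2 ^ m \<le> 2 ^ n"
    using m(1) by (simp add: B_def algebra_simps flip: power_add)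
  then have uv: "0 < u" "u \<le> a" "b \<le> v" "v < 2 ^ n"
    using rs p by (auto simp: u_def v_def)
  let ?vs = "[u..<Suc a] @ [b..<Suc v]"
  have "successively (\<lambda>x y. (x, y) \<in> parcs G) [u..<Suc a]"
       "successively (\<lambda>x y. (x, y) \<in> parcs G) [b..<Suc v]"
    by (rule successively_upt_Suc, use path uv arc in \<open>force simp: directed_path_def\<close>)+
  then have succ: "successively (\<lambda>x y. (x, y) \<in> parcs G) ?vs"
    using arc uv by (auto simp: successively_append_iff hd_upt simp del: upt_Suc)
  have ends: "hd ?vs = u" "last ?vs = v" "?vs \<noteq> []"
    using uv by (auto simp: hd_append hd_upt simp del: upt_Suc)
  have dist: "distinct ?vs" using arc(4) by auto
  have in_verts: "u \<in> pverts G" "v \<in> pverts G" "u \<noteq> v"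
    using uv arc verts by auto
  have f: "f u = ruler p" "f v = ruler p"
    using ruler[of u] ruler[of v] ruler_A[of p] ruler_B[of p] p in_verts verts
    by (auto simp: u_def v_def)
  obtain w where w: "w \<in> set ?vs" "ruler p < f w"
    using rank ends succ dist in_verts f unfolding k_ranking_iff by metis
  have "w \<in> {1..2 ^ n - 1}" using w(1) uv arc by auto
  then have fw: "f w = ruler w" by (rule ruler)
  \<comment> \<open>Reduced by \<open>A\<close> or \<open>B\<close>, each vertex of this path lies
    between \<open>s\<close> and \<open>r\<close>, where \<open>ruler p\<close> is the
    maximum.\<close>
  have "w \<in> {u..a} \<or> w \<in> {b..v}" using w(1) by auto
  then show False
  proof
    assume "w \<in> {u..a}"
    then have "w = A + (w - A)" "w - A \<in> {s..r}" using p rs by (auto simp: u_def)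
    then show False using ruler_A[of "w - A"] max[of "w - A"] fw w(2) by simp
  next
    assume "w \<in> {b..v}"
    then have "w = B + (w - B)" "w - B \<in> {s..r}" using p rs by (auto simp: v_def)
    then show False using ruler_B[of "w - B"] max[of "w - B"] fw w(2) by simp
  qed
qed


section \<open>The recursion for the arcs\<close>

text \<open>The condition is vacuous, as every modulus divides \<open>2 ^ n\<close>: the middle
  vertex is joined to all others.\<close>

lemma residue_less_pow2 [simp]: "residue_less n (2 ^ n) b" "residue_less n a (2 ^ n)"
  by (auto simp: residue_less_def le_imp_power_dvd)

text \<open>A shift by \<open>2 ^ n\<close> is invisible to the moduli up to \<open>2 ^ n\<close>,
  which explains both the copied and the crossing arcs.\<close>

lemma residue_less_shift [simp]:
  "residue_less n (2 ^ n + a) b \<longleftrightarrow> residue_less n a b"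
  "residue_less n a (2 ^ n + b) \<longleftrightarrow> residue_less n a b"
proof -
  have "(2 ^ n + x) mod 2 ^ m = x mod 2 ^ m" "2 ^ m dvd 2 ^ n + x \<longleftrightarrow> 2 ^ m dvd x"
    if "m \<le> n" for m x :: nat
  proof -
    have dvd: "(2::nat) ^ m dvd 2 ^ n" using that by (rule le_imp_power_dvd)
    then show "2 ^ m dvd 2 ^ n + x \<longleftrightarrow> 2 ^ m dvd x" by (rule dvd_add_right_iff)
    show "(2 ^ n + x) mod 2 ^ m = x mod 2 ^ m"
      using dvd by (metis add_0 dvd_eq_mod_eq_0 mod_add_left_eq)
  qed
  then show "residue_less n (2 ^ n + a) b \<longleftrightarrow> residue_less n a b"
    "residue_less n a (2 ^ n + b) \<longleftrightarrow> residue_less n a b"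
    by (simp_all add: residue_less_def)
qed

text \<open>The only new modulus is \<open>2 ^ Suc n\<close>; it exceeds both vertices and so
  compares the vertices themselves.\<close>

lemma residue_less_Suc:
  assumes "a \<in> {1..<2 ^ Suc n}" "b \<in> {1..<2 ^ Suc n}"
  shows "residue_less (Suc n) a b \<longleftrightarrow> a < b \<and> residue_less n a b"
proof -
  have "\<not> 2 ^ Suc n dvd a" "\<not> 2 ^ Suc n dvd b" "a mod 2 ^ Suc n = a" "b mod 2 ^ Suc n = b"
    using assms by (auto dest: dvd_imp_le)
  then show ?thesis unfolding residue_less_def le_Suc_eq by auto
qed

text \<open>Each end lies left of, at or right of \<open>2 ^ n\<close>. The condition
  \<open>a < b\<close> only rules out arcs from right to left; within one half it already follows
  from the residue condition.\<close>

lemma residue_arcs_Suc: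
  "residue_arcs (Suc n) =
     residue_arcs n
     \<union> (\<lambda>(a, b). (2 ^ n + a, 2 ^ n + b)) ` residue_arcs n
     \<union> (\<lambda>j. (j, 2 ^ n)) ` {1..<2 ^ n}
     \<union> (\<lambda>j. (2 ^ n, 2 ^ n + j)) ` {1..<2 ^ n}
     \<union> (\<lambda>(a, b). (a, 2 ^ n + b)) ` residue_arcs n"
  (is "_ = ?R")
proof -
  have iff: "(a, b) \<in> residue_arcs (Suc n) \<longleftrightarrow>
      a \<in> {1..<2 ^ n + 2 ^ n} \<and> b \<in> {1..<2 ^ n + 2 ^ n} \<and> a < b \<and> residue_less n a b" for a b
    unfolding residue_arcs_def using residue_less_Suc[of a n b] by (auto simp: mult_2)
  have split: "x \<in> {1..<2 ^ n} \<or> x = 2 ^ n \<or> (\<exists>y. x = 2 ^ n + y \<and> y \<in> {1..<2 ^ n})"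
    if "x \<in> {1..<2 ^ n + 2 ^ n}" for x :: nat
  proof (cases "x \<le> 2 ^ n")
    case False
    then have "x = 2 ^ n + (x - 2 ^ n)" "x - 2 ^ n \<in> {1..<2 ^ n}" using that by auto
    then show ?thesis by blast
  qed (use that in auto)
  show ?thesis
  proof (intro subset_antisym subrelI)
    fix a b assume "(a, b) \<in> residue_arcs (Suc n)"
    then have ab: "a \<in> {1..<2 ^ n + 2 ^ n}" "b \<in> {1..<2 ^ n + 2 ^ n}" "a < b" "residue_less n a b"
      unfolding iff by blast+
    from split[OF ab(1)] split[OF ab(2)] show "(a, b) \<in> ?R"
      using ab(3,4) by (elim disjE exE conjE) (auto simp: residue_arcs_def image_iff)
  next
    fix a b assume "(a, b) \<in> ?R"
    moreover have "x < y" "1 \<le> x" "y < 2 ^ n" "residue_less n x y" if "(x, y) \<in> residue_arcs n" for x y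
      using that residue_arcs_less[OF that] by (auto simp: residue_arcs_def)
    ultimately show "(a, b) \<in> residue_arcs (Suc n)"
      unfolding iff by (fastforce simp: trans_less_add1)
  qed
qed

lemma finite_residue_arcs: "finite (residue_arcs n)"
  by (rule finite_subset[of _ "{1..<2 ^ n} \<times> {1..<2 ^ n}"]) (auto simp: residue_arcs_def)

text \<open>Three disjoint copies of \<open>residue_arcs n\<close> and two stars at
  \<open>2 ^ n\<close> give the recurrence \<open>x' = 3 * x + 2 * (2 ^ n - 1)\<close>.\<close>

lemma card_residue_arcs: "int (card (residue_arcs n)) = 3 ^ n - 2 ^ (n + 1) + 1"
proof (induction n)
  case 0
  then show ?case by (simp add: residue_arcs_def)
next
  case (Suc n)
  let ?R = "residue_arcs n"
  have R: "a \<in> {1..<2 ^ n} \<and> b \<in> {1..<2 ^ n}" if "(a, b) \<in> ?R" for a b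
    using that by (auto simp: residue_arcs_def)
  note [simp] = finite_residue_arcs
  have "card (residue_arcs (Suc n)) =
      card ?R + card ((\<lambda>(a, b). (2 ^ n + a, 2 ^ n + b)) ` ?R)
      + card ((\<lambda>j. (j, 2 ^ n :: nat)) ` {1..<(2::nat) ^ n})
      + card ((\<lambda>j. (2 ^ n :: nat, 2 ^ n + j)) ` {1..<(2::nat) ^ n})
      + card ((\<lambda>(a, b). (a, 2 ^ n + b)) ` ?R)"
    unfolding residue_arcs_Suc
    by (subst card_Un_disjoint; (auto dest!: R; fail)?)+
  also have "\<dots> = 3 * card ?R + 2 * (2 ^ n - 1)"
    by (simp add: card_image inj_on_def split_beta prod_eq_iff)
      (use one_le_power[of "2::nat" n] in linarith)
  finally show ?case using Suc.IH by (simp add: of_nat_diff)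
qed

lemma direct_sum_graph_eq:
  assumes "n \<ge> 2"
  shows "direct_sum_graph n = \<lparr>pverts = {1..2 ^ n - 1}, parcs = residue_arcs n\<rparr>"
  using assms
proof (induction n rule: dec_induct)
  case base
  \<comment> \<open>The arcs for index 2 are computed by running the recursion up from the empty set
    at index 0.\<close>
  have "residue_arcs 0 = {}" by (auto simp: residue_arcs_def)
  then have "residue_arcs 1 = {}" using residue_arcs_Suc[of 0] by simp
  then have "residue_arcs 2 = {(1, 2), (2, 3)}"
    using residue_arcs_Suc[of 1] by (auto simp: numeral_2_eq_2 atLeastLessThanSuc)
  moreover have "{(i, i + 1) | i :: nat. 1 \<le> i \<and> i < 3} = {(1, 2), (2, 3)}"
    by auto
  ultimately show ?case by (simp add: numeral_2_eq_2 directed_path_def)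
next
  case (step n)
  have "{1..2 ^ n - 1} \<union> (+) (2 ^ n) ` {1..2 ^ n - 1} \<union> {2 ^ n} = {1..2 ^ Suc n - (1::nat)}"
    (is "?V = _")
  proof (intro set_eqI iffI)
    fix x assume "x \<in> {1..2 ^ Suc n - (1::nat)}"
    then show "x \<in> ?V"
      by (cases "x \<le> 2 ^ n") (auto intro!: image_eqI[of _ _ "x - 2 ^ n"])
  qed auto
  moreover have "residue_arcs n \<union> {(2 ^ n + a, 2 ^ n + b) | a b. (a, b) \<in> residue_arcs n}
      \<union> {(j, 2 ^ n) | j. 1 \<le> j \<and> j \<le> 2 ^ n - 1}
      \<union> {(2 ^ n, 2 ^ n + j) | j. 1 \<le> j \<and> j \<le> 2 ^ n - 1}
      \<union> {(k, 2 ^ n + j) | k j. (k, j) \<in> residue_arcs n} = residue_arcs (Suc n)"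
    unfolding residue_arcs_Suc by (intro arg_cong2[of _ _ _ _ "(\<union>)"]) force+
  ultimately show ?case
    using step by (simp add: direct_sum_step_def Let_def)
qed

text \<open>With \<open>Stirling (n + 1) 2 = 2 ^ n - 1\<close>, the Stirling recurrence becomes,
  after doubling, the one that counts the arcs.\<close>

lemma Stirling_3: "int (2 * Stirling (n + 1) 3) = 3 ^ n - 2 ^ (n + 1) + 1"
proof (induction n)
  case (Suc n)
  have "Stirling (Suc n + 1) 3 = 3 * Stirling (n + 1) 3 + (2 ^ n - 1)"
    using Stirling_2[of n] by (simp add: numeral_3_eq_3)
  then have "int (Stirling (Suc n + 1) 3) = 3 * int (Stirling (n + 1) 3) + (2 ^ n - 1)"
    by (simp only: of_nat_add of_nat_mult of_nat_diff one_le_power) simp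
  with Suc show ?case by simp
qed (simp add: numeral_3_eq_3)


section \<open>Minimum labelings and admissible edges\<close>

lemma k_ranking_path_ge:
  assumes "k_ranking k G f" "pverts G = {1..2 ^ n - 1}"
    "parcs (directed_path (2 ^ n - 1)) \<subseteq> parcs G"
  shows "n \<le> k"
proof -
  have "k_ranking k (directed_path (2 ^ n - 1)) f"
    by (rule k_ranking_subgraph[OF assms(1)]) (use assms in \<open>auto simp: directed_path_def\<close>)
  from interval_ranking_length[OF k_ranking_directed_path[OF this]]
  have "2 ^ n - 1 < (2::nat) ^ k" by simp
  then have "(2::nat) ^ n \<le> 2 ^ k" by linarith
  then show ?thesis by simp
qed

text \<open>A ranking of \<open>G\<close> also ranks the path it contains, so the values are forced;
  extensionality turns this into equality of functions.\<close>

lemma k_ranking_path_unique: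
  assumes "k_ranking n G f" "pverts G = {1..2 ^ n - 1}"
    "parcs (directed_path (2 ^ n - 1)) \<subseteq> parcs G"
  shows "f = restrict ruler {1..2 ^ n - 1}"
proof -
  have "k_ranking n (directed_path (2 ^ n - 1)) f"
    by (rule k_ranking_subgraph[OF assms(1)]) (use assms in \<open>auto simp: directed_path_def\<close>)
  then have "interval_ranking n (Suc 0) (0 + 2 ^ n) f"
    using k_ranking_directed_path[of n "2 ^ n - 1" f] by simp
  then have "f i = ruler i" if "0 < i" "i < 2 ^ n" for i
    using interval_ranking_unique[of n 0 f i] that by simp
  moreover have "f \<in> extensional {1..2 ^ n - 1}"
    using assms by (auto simp: k_ranking_iff PiE_def)
  ultimately show ?thesis by (auto simp: fun_eq_iff extensional_def)
qed

text \<open>The rank is squeezed: the path inside \<open>G\<close> forces at least \<open>n\<close>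
  labels, and the ruler labeling of the larger arc set achieves \<open>n\<close>.\<close>

lemma
  assumes "pverts G = {1..2 ^ n - 1}" "parcs (directed_path (2 ^ n - 1)) \<subseteq> parcs G"
    "parcs G \<subseteq> residue_arcs n"
  shows k_ranking_ruler: "k_ranking n G (restrict ruler {1..2 ^ n - 1})"
    and rank_number_between: "rank_number G = n"
proof -
  show rank: "k_ranking n G (restrict ruler {1..2 ^ n - 1})"
    by (rule k_ranking_subgraph[OF ruler_ranks_residue_arcs]) (use assms in auto)
  show "rank_number G = n"
    by (rule rank_number_eqI[OF rank]) (use k_ranking_path_ge assms in blast)
qed

lemma admissible_type_I_iff:
  "admissible_type_I (2 ^ n - 1) e \<longleftrightarrow> e \<in> residue_arcs n - parcs (directed_path (2 ^ n - 1))"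
proof -
  let ?P = "directed_path (2 ^ n - 1)"
  obtain a b where e: "e = (a, b)" by (cases e)
  let ?G = "?P\<lparr>parcs := insert e (parcs ?P)\<rparr>"
  have verts: "pverts ?G = {1..2 ^ n - 1}" "pverts ?P = {1..2 ^ n - 1}"
    by (auto simp: directed_path_def)
  note path = directed_path_subset_residue_arcs[of n]
  have rank_P: "rank_number ?P = n"
    by (rule rank_number_between) (use verts path in auto)
  show ?thesis
  proof
    assume "admissible_type_I (2 ^ n - 1) e"
    then have adm: "a \<in> {1..2 ^ n - 1}" "b \<in> {1..2 ^ n - 1}" "a < b" "e \<notin> parcs ?P"
      "rank_number ?G = n"
      using rank_P verts by (auto simp: admissible_type_I_def admissible_def e)
    \<comment> \<open>An injective labeling is always a ranking, so some ranking exists and the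
      \<open>LEAST\<close> in \<open>rank_number\<close> is attained.\<close>
    have "k_ranking (2 ^ n) ?G (restrict (\<lambda>x. x) {1..2 ^ n - 1})"
      unfolding k_ranking_iff verts by auto
    then have "\<exists>f. k_ranking (2 ^ n) ?G f" by blast
    then have "\<exists>f. k_ranking (rank_number ?G) ?G f"
      unfolding rank_number_def by (rule LeastI)
    then obtain f where f: "k_ranking n ?G f"
      unfolding adm(5) by (rule exE)
    have "f = restrict ruler {1..2 ^ n - 1}"
      by (rule k_ranking_path_unique[OF f]) (use verts in auto)
    then have "(a, b) \<in> residue_arcs n"
      by (intro residue_arcs_if_ranked[OF f]) (use verts adm e in auto)
    then show "e \<in> residue_arcs n - parcs ?P" using adm e by simp
  next
    assume arc: "e \<in> residue_arcs n - parcs ?P"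
    have "rank_number ?G = n"
      by (rule rank_number_between) (use verts path arc in auto)
    moreover have "a < b" "a \<in> pverts ?P" "b \<in> pverts ?P"
      using arc residue_arcs_less[of a b n] verts by (auto simp: e residue_arcs_def)
    ultimately show "admissible_type_I (2 ^ n - 1) e"
      using arc rank_P by (simp add: admissible_type_I_def admissible_def e)
  qed
qed

theorem proposition2:
  fixes n :: nat
  assumes "n \<ge> 2"
  shows "(rank_number (direct_sum_graph n) = rank_number (directed_path (2 ^ n - 1)) \<and>
          rank_number (directed_path (2 ^ n - 1)) = n \<and>
          (\<exists>!f. minimum_labeling (direct_sum_graph n) f))
       \<and> (card (parcs (direct_sum_graph n)) = 2 * Stirling (n + 1) 3 \<and>
          int (2 * Stirling (n + 1) 3) = 3 ^ n - 2 ^ (n + 1) + 1)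
       \<and> (\<forall>e. admissible_type_I (2 ^ n - 1) e \<longleftrightarrow> e \<in> parcs (H_graph n))
       \<and> int (card {e. admissible_type_I (2 ^ n - 1) e}) =
           2 * (int (Stirling (n + 1) 3) - int (Stirling n 2))"
proof -
  let ?P = "directed_path (2 ^ n - 1)" and ?G = "direct_sum_graph n"
  note path = directed_path_subset_residue_arcs[of n]
  have G: "pverts ?G = {1..2 ^ n - 1}" "parcs ?G = residue_arcs n"
    using direct_sum_graph_eq[OF assms] by simp_all
  have rank_G: "rank_number ?G = n"
    by (rule rank_number_between) (use G path in auto)
  have rank_P: "rank_number ?P = n"
    by (rule rank_number_between) (use path in \<open>auto simp: directed_path_def\<close>)
  have "minimum_labeling ?G f \<longleftrightarrow> f = restrict ruler {1..2 ^ n - 1}" for f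
    unfolding minimum_labeling_def rank_G
    using k_ranking_path_unique[of n ?G f] k_ranking_ruler[of ?G n] G path by auto
  then have unique: "\<exists>!f. minimum_labeling ?G f" by simp
  have "int (card (parcs ?G)) = int (2 * Stirling (n + 1) 3)"
    unfolding G card_residue_arcs Stirling_3 ..
  then have card_G: "card (parcs ?G) = 2 * Stirling (n + 1) 3"
    by (simp only: of_nat_eq_iff)
  have H: "parcs (H_graph n) = residue_arcs n - parcs ?P"
    by (simp add: H_graph_def G)
  have "parcs ?P = (\<lambda>i. (i, i + 1)) ` {1..<2 ^ n - 1}"
    by (auto simp: directed_path_def)
  then have "card (parcs ?P) = 2 ^ n - 2"
    by (simp add: card_image inj_on_def)
  \<comment> \<open>Here \<open>2 ^ n - 2 = 2 * (2 ^ (n - 1) - 1)\<close>.\<close>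
  also have "\<dots> = 2 * Stirling n 2"
    using Stirling_2[of "n - 1"] assms
    by (cases n) (auto simp: numeral_2_eq_2 right_diff_distrib')
  finally have card_P: "card (parcs ?P) = 2 * Stirling n 2" .
  \<comment> \<open>Ensures that the natural-number difference of the cardinalities is the integer
    one.\<close>
  have "card (parcs ?P) \<le> card (residue_arcs n)"
    using path finite_residue_arcs by (rule card_mono[rotated])
  then have card_H: "int (card (residue_arcs n - parcs ?P)) = 2 * (int (Stirling (n + 1) 3) - int (Stirling n 2))"
    using card_Diff_subset[OF finite_subset[OF path finite_residue_arcs] path] card_G card_P G
    by (simp add: of_nat_diff)
  show ?thesis
    unfolding rank_G rank_P card_G admissible_type_I_iff H Collect_mem_eq card_H
    using unique Stirling_3 by blast
qed

end
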